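(* Let $\Gamma$ be a locally finite graph with vertex set $G$, and let $S\subset G$ be a nonempty finite subset which admits a cooling function. Then $S$ admits a cooling function $c$ of minimum possible cooling norm $N=|c|$, and $$N=|c|=\max_{S_0\subset S}\frac{|S_0|}{|\partial E(S_0)|},$$ where the ratio $|S_0|/|\partial E(S_0)|$ is taken to be $0$ for $S_0=\emptyset$.
   Context: For a finite $S\subset G$, $E(S)$ is the set of edges of $\Gamma$ having at least one vertex in $S$, and $\partial E(S)\subset E(S)$ is the set of edges having exactly one vertex in $S$. Each edge $e\in E(S)$ is given one of its two orientations, with initial vertex $i(e)$ and terminal vertex $t(e)$; for $e\in\partial E(S)$ the orientation is chosen so that $i(e)\in S$ (and $t(e)\notin S$); the other orientations are arbitrary. A cooling function for $S$ is a function $c:E(S)\to\mathbb R$ such that for every $s\in S$, $\sum_{i(e)=s}c(e)-\sum_{t(e)=s}c(e)\ge 1$. Its cooling norm is $|c|=\max_{e\in E(S)}|c(e)|$. The Følner ratio of a nonempty finite set $S_0$ is $|S_0|/|\partial E(S_0)|$ (if $S$ admits a cooling function then $\partial E(S_0)\neq\emptyset$ for every nonempty $S_0\subset S$). *)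

theory Defs
  imports Complex_Main
begin

text \<open>
  A graph is given by its vertex set \<open>G\<close>, its edge set \<open>E\<close>, and the map \<open>ends\<close> sending an edge to its
  set of endpoints. Multiple edges and loops are allowed; a loop has a single endpoint. Simple graphs
  are the case where \<open>ends\<close> is injective on \<open>E\<close> and every \<open>ends e\<close> has two elements.
\<close>

locale locally_finite_graph =
  fixes G :: "'v set" and E :: "'e set" and ends :: "'e \<Rightarrow> 'v set"
  assumes ends_subset: "e \<in> E \<Longrightarrow> ends e \<subseteq> G"
    and card_ends: "e \<in> E \<Longrightarrow> card (ends e) \<in> {1, 2}"
    and locally_finite: "v \<in> G \<Longrightarrow> finite {e \<in> E. v \<in> ends e}"

definition edges_of :: "'e set \<Rightarrow> ('e \<Rightarrow> 'v set) \<Rightarrow> 'v set \<Rightarrow> 'e set" where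
  "edges_of E ends S = {e \<in> E. ends e \<inter> S \<noteq> {}}"

text \<open>
  An edge is in the boundary of \<open>S\<close> if one of its ends is in \<open>S\<close> and the other one is not. In
  particular, a loop is never a boundary edge.
\<close>

definition edge_boundary :: "'e set \<Rightarrow> ('e \<Rightarrow> 'v set) \<Rightarrow> 'v set \<Rightarrow> 'e set" where
  "edge_boundary E ends S = {e \<in> E. \<exists>x y. ends e = {x, y} \<and> x \<in> S \<and> y \<notin> S}"

definition orientation_for ::
    "'e set \<Rightarrow> ('e \<Rightarrow> 'v set) \<Rightarrow> 'v set \<Rightarrow> ('e \<Rightarrow> 'v) \<Rightarrow> ('e \<Rightarrow> 'v) \<Rightarrow> bool" where
  "orientation_for E ends S i t \<longleftrightarrow>
     (\<forall>e \<in> edges_of E ends S. ends e = {i e, t e}) \<and>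
     (\<forall>e \<in> edge_boundary E ends S. i e \<in> S \<and> t e \<notin> S)"

text \<open>
  Functions on \<open>edges_of E ends S\<close> are represented by total functions; their values outside that
  set are irrelevant to the following two definitions.
\<close>

definition cooling_function ::
    "'e set \<Rightarrow> ('e \<Rightarrow> 'v set) \<Rightarrow> 'v set \<Rightarrow> ('e \<Rightarrow> 'v) \<Rightarrow> ('e \<Rightarrow> 'v) \<Rightarrow> ('e \<Rightarrow> real) \<Rightarrow> bool" where
  "cooling_function E ends S i t c \<longleftrightarrow>
     (\<forall>s \<in> S. (\<Sum>e \<in> {e \<in> edges_of E ends S. i e = s}. c e)
            - (\<Sum>e \<in> {e \<in> edges_of E ends S. t e = s}. c e) \<ge> 1)"

definition cooling_norm :: "'e set \<Rightarrow> ('e \<Rightarrow> 'v set) \<Rightarrow> 'v set \<Rightarrow> ('e \<Rightarrow> real) \<Rightarrow> real" where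
  "cooling_norm E ends S c = Max ((\<lambda>e. \<bar>c e\<bar>) ` edges_of E ends S)"

definition folner_ratio :: "'e set \<Rightarrow> ('e \<Rightarrow> 'v set) \<Rightarrow> 'v set \<Rightarrow> real" where
  "folner_ratio E ends S0 =
     (if S0 = {} then 0 else real (card S0) / real (card (edge_boundary E ends S0)))"

context locally_finite_graph
begin

lemma finite_edges_of:
  assumes "finite S" "S \<subseteq> G"
  shows "finite (edges_of E ends S)"
proof -
  have "edges_of E ends S = (\<Union>v\<in>S. {e \<in> E. v \<in> ends e})"
    by (auto simp: edges_of_def)
  then show ?thesis
    using assms locally_finite by auto
qed

lemma finite_edge_boundary:
  assumes "finite S" "S \<subseteq> G"
  shows "finite (edge_boundary E ends S)"
  by (rule finite_subset[OF _ finite_edges_of[OF assms]])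
     (auto simp: edges_of_def edge_boundary_def)

text \<open>
  The maxima in \<^const>\<open>cooling_norm\<close> and the quotients in \<^const>\<open>folner_ratio\<close> are therefore
  well defined as soon as \<open>S\<close> admits a cooling function.
\<close>

lemma edge_boundary_nonempty:
  assumes "finite S" "S \<subseteq> G"
    and ori: "orientation_for E ends S i t"
    and cool: "cooling_function E ends S i t c"
    and S0: "S0 \<subseteq> S" "S0 \<noteq> {}"
  shows "edge_boundary E ends S0 \<noteq> {}"
proof
  assume empty: "edge_boundary E ends S0 = {}"
  define F where "F = edges_of E ends S"
  have finF: "finite F" and finS0: "finite S0"
    using finite_edges_of[OF assms(1,2)] assms(1) S0(1) finite_subset by (auto simp: F_def)
  have regroup: "(\<Sum>s\<in>S0. \<Sum>e\<in>{e \<in> F. f e = s}. c e) = (\<Sum>e\<in>{e \<in> F. f e \<in> S0}. c e)"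
    for f :: "'e \<Rightarrow> 'v"
  proof -
    have "(\<Sum>s\<in>S0. \<Sum>e\<in>{e \<in> {e \<in> F. f e \<in> S0}. f e = s}. c e) = (\<Sum>e\<in>{e \<in> F. f e \<in> S0}. c e)"
      by (rule sum.group) (use finF finS0 in auto)
    moreover have "{e \<in> {e \<in> F. f e \<in> S0}. f e = s} = {e \<in> F. f e = s}" if "s \<in> S0" for s
      using that by auto
    ultimately show ?thesis
      by simp
  qed
  have "i e \<in> S0 \<longleftrightarrow> t e \<in> S0" if "e \<in> F" for e
  proof -
    have "e \<in> E" "ends e = {i e, t e}" "ends e = {t e, i e}"
      using ori that by (auto simp: orientation_for_def F_def edges_of_def)
    then show ?thesis
      using empty unfolding edge_boundary_def by blast
  qed
  then have "{e \<in> F. i e \<in> S0} = {e \<in> F. t e \<in> S0}"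
    by auto
  then have "(\<Sum>s\<in>S0. (\<Sum>e\<in>{e \<in> F. i e = s}. c e) - (\<Sum>e\<in>{e \<in> F. t e = s}. c e)) = 0"
    by (simp add: sum_subtractf regroup)
  moreover have "(\<Sum>s\<in>S0. (\<Sum>e\<in>{e \<in> F. i e = s}. c e) - (\<Sum>e\<in>{e \<in> F. t e = s}. c e)) \<ge> (\<Sum>s\<in>S0. 1)"
    by (rule sum_mono) (use cool S0(1) in \<open>auto simp: cooling_function_def F_def\<close>)
  moreover have "card S0 > 0"
    using finS0 S0(2) by (simp add: card_gt_0_iff)
  ultimately show False
    by simp
qed

end

end

theory Submission
  imports Defs "HOL-Analysis.Function_Topology"
begin

text \<open>
  Summing the cooling condition over \<open>S0 \<subseteq> S\<close> leaves only the boundary edges of \<open>S0\<close>, so every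
  cooling norm is at least every Folner ratio. Conversely, let \<open>N\<close> be the largest ratio. Among all
  \<open>c\<close> with \<open>\<bar>c\<bar> \<le> N\<close> choose one minimising the sum of the squared deficits
  \<open>d s = max 0 (1 - outflow s)\<close> over \<open>S\<close>, with \<open>d = 0\<close> outside \<open>S\<close>. By minimality every edge joining
  vertices of different deficit is saturated towards the one of smaller deficit. If the largest
  deficit \<open>m\<close> were positive, all boundary edges of \<open>R = {s. d s = m}\<close> would carry \<open>N\<close> out of \<open>R\<close>,
  so that \<open>\<bar>R\<bar> (1 - m) = N \<bar>\<partial>R\<bar> \<ge> \<bar>R\<bar>\<close>, which is absurd.
\<close>

definition outflow :: "'e set \<Rightarrow> ('e \<Rightarrow> 'v) \<Rightarrow> ('e \<Rightarrow> 'v) \<Rightarrow> ('e \<Rightarrow> real) \<Rightarrow> 'v \<Rightarrow> real" where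
  "outflow F i t c s = (\<Sum>e\<in>{e \<in> F. i e = s}. c e) - (\<Sum>e\<in>{e \<in> F. t e = s}. c e)"

text \<open>Phrased by the orientation maps alone, so that the flow results below need no graph. It
  ignores the direction of an edge, and loops drop out.\<close>

definition edge_cut :: "'e set \<Rightarrow> ('e \<Rightarrow> 'v) \<Rightarrow> ('e \<Rightarrow> 'v) \<Rightarrow> 'v set \<Rightarrow> 'e set" where
  "edge_cut F i t R = {e \<in> F. (i e \<in> R) \<noteq> (t e \<in> R)}"

lemma outflow_eq_sum:
  assumes "finite F"
  shows "outflow F i t c s = (\<Sum>e\<in>F. c e * (of_bool (i e = s) - of_bool (t e = s)))"
proof -
  have "(\<Sum>e\<in>{e \<in> F. f e = s}. c e) = (\<Sum>e\<in>F. c e * of_bool (f e = s))" for f :: "'a \<Rightarrow> 'b"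
    using assms by (intro sum.mono_neutral_cong_left) auto
  then show ?thesis
    by (simp add: outflow_def sum_subtractf right_diff_distrib)
qed

text \<open>An edge with both ends in \<open>R\<close> is counted once with each sign and cancels;
  an edge with no end in \<open>R\<close> is never counted.\<close>

lemma sum_outflow:
  assumes "finite F" "finite R"
  shows "(\<Sum>s\<in>R. outflow F i t c s) = (\<Sum>e\<in>edge_cut F i t R. if i e \<in> R then c e else - c e)"
proof -
  have ind: "(\<Sum>s\<in>R. of_bool (x = s) :: real) = of_bool (x \<in> R)" for x
    using assms(2) by (simp add: of_bool_def)
  have "(\<Sum>s\<in>R. outflow F i t c s)
      = (\<Sum>e\<in>F. \<Sum>s\<in>R. c e * (of_bool (i e = s) - of_bool (t e = s)))"
    unfolding outflow_eq_sum[OF assms(1)] by (rule sum.swap)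
  also have "\<dots> = (\<Sum>e\<in>F. c e * (of_bool (i e \<in> R) - of_bool (t e \<in> R)))"
    by (simp add: sum_subtractf ind flip: sum_distrib_left)
  also have "\<dots> = (\<Sum>e\<in>edge_cut F i t R. if i e \<in> R then c e else - c e)"
    unfolding edge_cut_def using assms(1) by (intro sum.mono_neutral_cong_right) auto
  finally show ?thesis .
qed

lemma outflow_fun_upd:
  assumes "finite F" "e \<in> F"
  shows "outflow F i t (c(e := c e + x)) s
       = outflow F i t c s + x * (of_bool (i e = s) - of_bool (t e = s))"
  unfolding outflow_eq_sum[OF assms(1)]
  by (simp add: sum.remove[OF assms] distrib_right)

text \<open>Replacing \<open>d u\<close> and \<open>d v\<close> by \<open>d u - x\<close> and
  \<open>d v + x\<close> changes the sum of their squares by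
  \<open>2 * x * (x - (d u - d v))\<close>, which is negative. Nonnegativity of \<open>d'\<close>
  allows its upper bounds to be squared. If \<open>v\<close> lies outside \<open>S\<close>, only the
  decrease at \<open>u\<close> counts.\<close>

lemma sum_squares_transfer_less:
  fixes d d' :: "'v \<Rightarrow> real"
  assumes "finite S" "u \<in> S" "u \<noteq> v"
    and "0 < x" "x < d u - d v" "0 \<le> d v"
    and "\<And>s. 0 \<le> d' s" and "d' u \<le> d u - x" and "d' v \<le> d v + x"
    and "\<And>s. s \<in> S \<Longrightarrow> s \<noteq> u \<Longrightarrow> s \<noteq> v \<Longrightarrow> d' s = d s"
  shows "(\<Sum>s\<in>S. (d' s)\<^sup>2) < (\<Sum>s\<in>S. (d s)\<^sup>2)"
proof -
  have u: "(d' u)\<^sup>2 \<le> (d u - x)\<^sup>2" and v: "(d' v)\<^sup>2 \<le> (d v + x)\<^sup>2"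
    using assms by (auto intro: power_mono)
  have "x * x < x * (d u - d v)"
    using assms by simp
  then have uv: "(d u - x)\<^sup>2 + (d v + x)\<^sup>2 < (d u)\<^sup>2 + (d v)\<^sup>2"
    by (simp add: power2_eq_square algebra_simps)
  have u': "(d u - x)\<^sup>2 < (d u)\<^sup>2"
    using assms by (intro power_strict_mono) auto
  show ?thesis
  proof (cases "v \<in> S")
    case True
    have "(\<Sum>s\<in>S. f s) = f u + f v + (\<Sum>s\<in>S - {u, v}. f s)" for f :: "'v \<Rightarrow> real"
    proof -
      have "(\<Sum>s\<in>S. f s) = (\<Sum>s\<in>{u, v}. f s) + (\<Sum>s\<in>S - {u, v}. f s)"
        using assms(1,2) True by (subst sum.subset_diff[of "{u, v}"]) auto
      then show ?thesis
        using assms(3) by simp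
    qed
    moreover have "(\<Sum>s\<in>S - {u, v}. (d' s)\<^sup>2) = (\<Sum>s\<in>S - {u, v}. (d s)\<^sup>2)"
      using assms(10) by (intro sum.cong) auto
    ultimately show ?thesis
      using u v uv by (simp del: sum.insert)
  next
    case False
    have "(\<Sum>s\<in>S - {u}. (d' s)\<^sup>2) = (\<Sum>s\<in>S - {u}. (d s)\<^sup>2)"
    proof (rule sum.cong)
      fix s assume "s \<in> S - {u}"
      then show "(d' s)\<^sup>2 = (d s)\<^sup>2"
        using assms(10)[of s] False by (cases "s = v") simp_all
    qed simp
    then show ?thesis
      using u u' by (simp add: sum.remove[OF assms(1,2)])
  qed
qed

text \<open>
  Gale's supply-demand theorem for networks with symmetric capacities \<open>k\<close>; vertices outside \<open>S\<close>
  absorb flow freely.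
\<close>

lemma exists_flow_with_outflow:
  fixes w :: "'v \<Rightarrow> real" and k :: "'e \<Rightarrow> real" and i t :: "'e \<Rightarrow> 'v"
  assumes finF: "finite F" and finS: "finite S"
    and k0: "\<And>e. e \<in> F \<Longrightarrow> 0 \<le> k e"
    and cuts: "\<And>R. R \<subseteq> S \<Longrightarrow> sum w R \<le> sum k (edge_cut F i t R)"
  obtains c where "\<And>e. e \<in> F \<Longrightarrow> \<bar>c e\<bar> \<le> k e" and "\<And>s. s \<in> S \<Longrightarrow> w s \<le> outflow F i t c s"
proof -
  define d where "d c s = (if s \<in> S then max 0 (w s - outflow F i t c s) else 0)" for c s
  \<comment> \<open>Pinning the values off \<open>F\<close> to 0 makes \<open>K\<close> a product of
    compact sets over the whole edge type, compact by Tychonoff.\<close>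
  define K where "K = Pi\<^sub>E UNIV (\<lambda>e. if e \<in> F then {- k e..k e} else {0})"
  have K_iff: "f \<in> K \<longleftrightarrow> (\<forall>e\<in>F. \<bar>f e\<bar> \<le> k e) \<and> (\<forall>e. e \<notin> F \<longrightarrow> f e = 0)" for f
    unfolding K_def by (auto simp: PiE_iff abs_le_iff minus_le_iff split: if_splits)
  have d_nonneg: "0 \<le> d c s" for c s
    by (simp add: d_def)
  have "compactin (product_topology (\<lambda>_. euclidean) UNIV) K"
    unfolding K_def compactin_PiE by (auto simp: compactin_euclidean_iff)
  then have "compact K"
    by (simp add: euclidean_product_topology compactin_euclidean_iff)
  moreover have "(\<lambda>_. 0) \<in> K"
    using k0 by (simp add: K_iff)
  moreover have "continuous_on K (\<lambda>c. \<Sum>s\<in>S. (d c s)\<^sup>2)"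
  proof -
    have "continuous_on K (\<lambda>c. c e)" for e
      by (rule continuous_on_subset[OF continuous_on_product_coordinates]) simp
    then have "continuous_on K (\<lambda>c. outflow F i t c s)" for s
      unfolding outflow_eq_sum[OF finF] by (intro continuous_on_sum continuous_on_mult continuous_on_const)
    then have "continuous_on K (\<lambda>c. d c s)" if "s \<in> S" for s
      using that unfolding d_def
      by (simp only: if_True) (intro continuous_on_max continuous_on_diff continuous_on_const)
    then show ?thesis
      by (intro continuous_on_sum continuous_on_power)
  qed
  ultimately obtain c where cK: "c \<in> K"
    and min: "\<And>c'. c' \<in> K \<Longrightarrow> (\<Sum>s\<in>S. (d c s)\<^sup>2) \<le> (\<Sum>s\<in>S. (d c' s)\<^sup>2)"
    using continuous_attains_inf[of K] by blast
  have bound: "\<bar>c e\<bar> \<le> k e" if "e \<in> F" for e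
    using cK that by (simp add: K_iff)
  \<comment> \<open>An extra flow \<open>x\<close> is pushed along \<open>e\<close> from
    \<open>v\<close>'s side of the balance to \<open>u\<close>'s: the outflow rises by
    \<open>x\<close> at \<open>u\<close> and falls by \<open>x\<close> at \<open>v\<close>. The sign
    \<open>\<sigma>\<close> is 1 if \<open>e\<close> is oriented from \<open>u\<close> to
    \<open>v\<close> and -1 if it is reversed; \<open>y\<close> is the spare capacity.\<close>
  have no_transfer: False
    if e: "e \<in> F" and less: "d c v < d c u" and y: "0 < y"
      and room: "\<And>x. 0 < x \<Longrightarrow> x \<le> y \<Longrightarrow> \<bar>c e + \<sigma> * x\<bar> \<le> k e"
      and \<sigma>: "\<And>s. \<sigma> * (of_bool (i e = s) - of_bool (t e = s)) = of_bool (u = s) - of_bool (v = s)"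
    for e u v \<sigma> y
  proof -
    \<comment> \<open>Half the deficit gap keeps \<open>x\<close> strictly below the gap, so the sum
      of squares strictly decreases.\<close>
    define x where "x = min y ((d c u - d c v) / 2)"
    have x: "0 < x" "x \<le> y" "x < d c u - d c v"
      using less y by (auto simp: x_def min_def)
    define c' where "c' = c(e := c e + \<sigma> * x)"
    have "c' \<in> K"
      using cK e room[OF x(1,2)] by (simp add: K_iff c'_def)
    have flow: "outflow F i t c' s = outflow F i t c s + x * (of_bool (u = s) - of_bool (v = s))" for s
      unfolding c'_def outflow_fun_upd[OF finF e] \<sigma>[symmetric] by (simp only: mult_ac)
    have uS: "u \<in> S"
      using less d_nonneg[of c v] by (auto simp: d_def split: if_splits)
    have "u \<noteq> v"
      using less by auto
    have "(\<Sum>s\<in>S. (d c' s)\<^sup>2) < (\<Sum>s\<in>S. (d c s)\<^sup>2)"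
      using finS uS \<open>u \<noteq> v\<close> x(1,3) d_nonneg[of c v] d_nonneg[of c']
    proof (rule sum_squares_transfer_less)
      have "d c u - x \<ge> 0"
        using x(3) d_nonneg[of c v] by simp
      then show "d c' u \<le> d c u - x"
        using uS \<open>u \<noteq> v\<close> by (simp add: d_def flow)
      show "d c' v \<le> d c v + x"
        using x(1) \<open>u \<noteq> v\<close> by (simp add: d_def flow)
      show "d c' s = d c s" if "s \<noteq> u" "s \<noteq> v" for s
        using that by (simp add: d_def flow)
    qed
    with min[OF \<open>c' \<in> K\<close>] show False
      by simp
  qed
  have saturated_i: "c e = k e" if "e \<in> F" "d c (t e) < d c (i e)" for e
  proof (rule ccontr)
    assume "c e \<noteq> k e"
    then show False
      using bound[OF that(1)] that
      by (intro no_transfer[of e "t e" "i e" "k e - c e" 1]) (auto simp: abs_le_iff)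
  qed
  \<comment> \<open>The improving push now runs against the orientation of \<open>e\<close>, where
    the spare capacity is \<open>k e + c e\<close>.\<close>
  have saturated_t: "c e = - k e" if "e \<in> F" "d c (i e) < d c (t e)" for e
  proof (rule ccontr)
    assume "c e \<noteq> - k e"
    then show False
      using bound[OF that(1)] that
      by (intro no_transfer[of e "i e" "t e" "k e + c e" "-1"]) (auto simp: abs_le_iff)
  qed
  have "w s \<le> outflow F i t c s" if "s \<in> S" for s
  proof (rule ccontr)
    assume "\<not> ?thesis"
    then have "0 < d c s"
      using that by (simp add: d_def)
    define m where "m = Max (d c ` S)"
    define R where "R = {s \<in> S. d c s = m}"
    have le_m: "d c r \<le> m" if "r \<in> S" for r
      using that finS by (simp add: m_def)
    have m: "0 < m"
      using le_m[OF that] \<open>0 < d c s\<close> by simp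
    have "m \<in> d c ` S"
      unfolding m_def using finS that by (intro Max_in) auto
    then have R: "R \<subseteq> S" "R \<noteq> {}" "finite R"
      using finS by (auto simp: R_def)
    \<comment> \<open>This includes the vertices outside \<open>S\<close>: their deficit is 0 by
      definition, and \<open>m\<close> is positive.\<close>
    have less_m: "d c r < m" if "r \<notin> R" for r
      using that le_m[of r] m by (cases "r \<in> S") (auto simp: R_def d_def)
    have "(\<Sum>s\<in>R. outflow F i t c s) = sum k (edge_cut F i t R)"
      unfolding sum_outflow[OF finF R(3)]
    proof (rule sum.cong)
      fix e assume "e \<in> edge_cut F i t R"
      then show "(if i e \<in> R then c e else - c e) = k e"
        using saturated_i[of e] saturated_t[of e] less_m[of "i e"] less_m[of "t e"]
        by (auto simp: edge_cut_def R_def)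
    qed simp
    moreover have "(\<Sum>s\<in>R. outflow F i t c s) < sum w R"
      using R m by (intro sum_strict_mono) (auto simp: R_def d_def)
    ultimately show False
      using cuts[OF R(1)] by simp
  qed
  with bound that show thesis
    by blast
qed

text \<open>Since \<open>R\<close> lies in \<open>S\<close>, its boundary edges are among those that
  \<open>i\<close> and \<open>t\<close> describe. The orientation is adapted to \<open>S\<close>
  only, so such an edge may point into \<open>R\<close>.\<close>

lemma edge_boundary_eq_cut:
  assumes "orientation_for E ends S i t" "R \<subseteq> S"
  shows "edge_boundary E ends R = edge_cut (edges_of E ends S) i t R"
proof (intro set_eqI iffI)
  fix e assume "e \<in> edge_boundary E ends R"
  then obtain x y where e: "e \<in> E" "ends e = {x, y}" "x \<in> R" "y \<notin> R"
    by (auto simp: edge_boundary_def)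
  then have "e \<in> edges_of E ends S"
    using assms(2) by (auto simp: edges_of_def)
  moreover from this have "{i e, t e} = {x, y}"
    using assms(1) e(2) by (auto simp: orientation_for_def)
  ultimately show "e \<in> edge_cut (edges_of E ends S) i t R"
    using e(3,4) by (auto simp: edge_cut_def doubleton_eq_iff)
next
  fix e assume e: "e \<in> edge_cut (edges_of E ends S) i t R"
  then have "e \<in> E" "ends e = {i e, t e}" "ends e = {t e, i e}"
    using assms(1) by (auto simp: orientation_for_def edge_cut_def edges_of_def)
  then show "e \<in> edge_boundary E ends R"
    using e unfolding edge_boundary_def edge_cut_def by blast
qed

lemma cooling_function_iff_outflow:
  "cooling_function E ends S i t c \<longleftrightarrow> (\<forall>s\<in>S. 1 \<le> outflow (edges_of E ends S) i t c s)"
  by (simp add: cooling_function_def outflow_def)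

theorem theorem1p3:
  fixes G :: "'v set" and E :: "'e set" and ends :: "'e \<Rightarrow> 'v set"
    and S :: "'v set" and i t :: "'e \<Rightarrow> 'v"
  assumes "locally_finite_graph G E ends"
    and "S \<subseteq> G" and "finite S" and "S \<noteq> {}"
    and "orientation_for E ends S i t"
    and "\<exists>c. cooling_function E ends S i t c"
  shows "\<exists>c. cooling_function E ends S i t c
           \<and> (\<forall>c'. cooling_function E ends S i t c' \<longrightarrow> cooling_norm E ends S c \<le> cooling_norm E ends S c')
           \<and> cooling_norm E ends S c = Max (folner_ratio E ends ` Pow S)"
proof -
  interpret locally_finite_graph G E ends
    by fact
  define F where "F = edges_of E ends S"
  define N where "N = Max (folner_ratio E ends ` Pow S)"
  note boundary = edge_boundary_eq_cut[OF assms(5), folded F_def]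
  have finF: "finite F"
    unfolding F_def using assms(2,3) by (simp add: finite_edges_of)
  have finR: "finite R" if "R \<subseteq> S" for R
    using that assms(3) by (rule finite_subset)
  have cut_pos: "0 < card (edge_cut F i t R)" if "R \<subseteq> S" "R \<noteq> {}" for R
    using assms(6) edge_boundary_nonempty[OF assms(3,2,5) _ that] finF
    by (auto simp: boundary[OF that(1)] card_gt_0_iff edge_cut_def)
  \<comment> \<open>Needed for the \<open>Max\<close> in the cooling norm to be meaningful.\<close>
  have "F \<noteq> {}"
    using cut_pos[OF subset_refl assms(4)] by (auto simp: edge_cut_def)
  have ratio_le: "folner_ratio E ends R \<le> N" if "R \<subseteq> S" for R
    unfolding N_def using that assms(3) by (intro Max_ge) auto
  \<comment> \<open>The convention that the empty set has ratio 0 gives the sign.\<close>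
  have "0 \<le> N"
    using ratio_le[of "{}"] by (simp add: folner_ratio_def)
  \<comment> \<open>This is the cut condition for demand 1 at each vertex and capacity
    \<open>N\<close> on each edge.\<close>
  have "card R \<le> N * card (edge_cut F i t R)" if "R \<subseteq> S" for R
  proof (cases "R = {}")
    case False
    then show ?thesis
      using ratio_le[OF that] cut_pos[OF that]
      by (simp add: folner_ratio_def boundary[OF that] divide_le_eq)
  qed (simp add: \<open>0 \<le> N\<close>)
  then obtain c where c_le: "\<And>e. e \<in> F \<Longrightarrow> \<bar>c e\<bar> \<le> N"
    and c_out: "\<And>s. s \<in> S \<Longrightarrow> 1 \<le> outflow F i t c s"
    using exists_flow_with_outflow[of F S "\<lambda>_. N" "\<lambda>_. 1" i t] finF assms(3) \<open>0 \<le> N\<close>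
    by (auto simp: mult.commute)
  have lower: "N \<le> cooling_norm E ends S c'" if "cooling_function E ends S i t c'" for c'
  proof -
    let ?M = "cooling_norm E ends S c'"
    have abs_le: "\<bar>c' e\<bar> \<le> ?M" if "e \<in> F" for e
      unfolding cooling_norm_def F_def[symmetric] using that finF by (intro Max_ge) auto
    have "0 \<le> ?M"
      using abs_le \<open>F \<noteq> {}\<close> by force
    have "folner_ratio E ends R \<le> ?M" if R: "R \<subseteq> S" for R
    proof (cases "R = {}")
      case False
      have "card R = (\<Sum>s\<in>R. 1 :: real)"
        by simp
      also have "\<dots> \<le> (\<Sum>s\<in>R. outflow F i t c' s)"
        using that R \<open>cooling_function E ends S i t c'\<close>
        by (intro sum_mono) (auto simp: cooling_function_iff_outflow F_def)
      also have "\<dots> = (\<Sum>e\<in>edge_cut F i t R. if i e \<in> R then c' e else - c' e)"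
        using finF finR[OF R] by (rule sum_outflow)
      also have "\<dots> \<le> (\<Sum>e\<in>edge_cut F i t R. ?M)"
        using abs_le by (intro sum_mono) (auto simp: edge_cut_def abs_le_iff minus_le_iff)
      finally show ?thesis
        using False cut_pos[OF R]
        by (simp add: folner_ratio_def boundary[OF R] divide_le_eq mult.commute)
    qed (simp add: folner_ratio_def \<open>0 \<le> ?M\<close>)
    then show ?thesis
      unfolding N_def using assms(3) by (subst Max_le_iff) auto
  qed
  have cool: "cooling_function E ends S i t c"
    using c_out by (simp add: cooling_function_iff_outflow F_def)
  have "cooling_norm E ends S c \<le> N"
    unfolding cooling_norm_def F_def[symmetric] using finF \<open>F \<noteq> {}\<close> c_le
    by (subst Max_le_iff) auto
  \<comment> \<open>The lower bound applies to \<open>c\<close> itself, and for every other cooling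
    function it gives minimality.\<close>
  then have "cooling_norm E ends S c = N"
    using lower[OF cool] by simp
  then show ?thesis
    using cool lower N_def by auto
qed

end
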